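(* Let $V$ be a rank one valuation domain with quotient field $K$ and valuation $v$. Let $E=\{s_n\}_{n\in\mathbb{N}}\subset K$ be a pseudo-convergent sequence that is either of transcendental type or of algebraic type and non-zero breadth ideal. Then the map $w_E:K(X)\to\mathbb{R}\cup\{\infty\}$, $w_E(\phi)=\lim_{n\to\infty}v(\phi(s_n))$, extends $v$ and is a valuation of rank one on $K(X)$. Furthermore, the valuation ring $W_E=\{\phi\in K(X)\mid w_E(\phi)\geq 0\}$ of $w_E$ contains $V_E=\{\phi\in K(X)\mid \phi(s_n)\in V\text{ for all but finitely many }n\in\mathbb{N}\}$.
   Context: $V$ has rank one and its value group $\Gamma_v$ is regarded as a totally ordered subgroup of $\mathbb{R}$. A sequence $E=\{s_n\}_{n\in\mathbb{N}}$ in $K$ is pseudo-convergent if $v(s_{n+1}-s_n)<v(s_{n+2}-s_{n+1})$ for all $n$. The breadth ideal of $E$ is $\mathrm{Br}(E)=\{b\in K\mid v(b)>v(s_{n+1}-s_n)\ \forall n\in\mathbb{N}\}$. $E$ is of transcendental type if $v(f(s_n))$ is eventually constant for every $f\in K[X]$, and of algebraic type if $v(f(s_n))$ is eventually strictly increasing for some $f\in K[X]$. For $\phi\in K(X)$, $\phi(s_n)$ is defined for all large $n$. *)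

theory Defs
  imports
    "HOL-Library.Extended_Real"
    "HOL-Computational_Algebra.Polynomial"
    "HOL-Computational_Algebra.Fraction_Field"
begin

section \<open>Real-valued valuations and their rank\<close>

text \<open>
  Value groups are subgroups of the reals throughout, so a valuation takes values in
  \<^typ>\<open>ereal\<close>, with \<open>-\<infinity>\<close> excluded and \<open>\<infinity>\<close> reached only at \<open>0\<close>.  The trivial valuation is
  allowed here; it has rank \<open>0\<close>.
\<close>

definition is_valuation :: "('a::field \<Rightarrow> ereal) \<Rightarrow> bool" where
  "is_valuation v \<longleftrightarrow>
     v 0 = \<infinity> \<and>
     (\<forall>x. x \<noteq> 0 \<longrightarrow> \<bar>v x\<bar> \<noteq> \<infinity>) \<and>
     (\<forall>x y. v (x * y) = v x + v y) \<and>
     (\<forall>x y. min (v x) (v y) \<le> v (x + y))"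

definition valuation_ring :: "('a::field \<Rightarrow> ereal) \<Rightarrow> 'a set" where
  "valuation_ring v = {x. 0 \<le> v x}"

definition value_group :: "('a::field \<Rightarrow> ereal) \<Rightarrow> real set" where
  "value_group v = {r. \<exists>x. x \<noteq> 0 \<and> v x = ereal r}"

definition convex_subgroup :: "real set \<Rightarrow> real set \<Rightarrow> bool" where
  "convex_subgroup H G \<longleftrightarrow>
     H \<subseteq> G \<and> 0 \<in> H \<and> (\<forall>a\<in>H. \<forall>b\<in>H. a + b \<in> H) \<and> (\<forall>a\<in>H. - a \<in> H) \<and>
     (\<forall>h\<in>H. \<forall>g\<in>G. 0 \<le> g \<and> g \<le> h \<longrightarrow> g \<in> H)"

text \<open>
  The rank is the number of proper convex subgroups of the value group.  Since
  \<^const>\<open>card\<close> is \<open>0\<close> on infinite sets, only positive values of this number are meaningful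
  without a finiteness proof; rank \<open>= 1\<close> has its usual meaning.
\<close>

definition valuation_rank :: "('a::field \<Rightarrow> ereal) \<Rightarrow> nat" where
  "valuation_rank v = card {H. convex_subgroup H (value_group v) \<and> H \<noteq> value_group v}"


section \<open>Evaluation of rational functions\<close>

text \<open>
  \<open>K(X)\<close> is the fraction field of \<open>K[X]\<close>.  A rational function is defined at \<open>x\<close> if some
  representation \<open>p / q\<close> of it has \<open>q(x) \<noteq> 0\<close>; \<open>rf_eval\<close> is unspecified elsewhere.
\<close>

definition rf_const :: "'a::field \<Rightarrow> 'a poly fract" where
  "rf_const c = Fract [:c:] 1"

definition rf_defined_at :: "'a::field poly fract \<Rightarrow> 'a \<Rightarrow> bool" where
  "rf_defined_at \<phi> x \<longleftrightarrow> (\<exists>p q. \<phi> = Fract p q \<and> poly q x \<noteq> 0)"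

definition rf_eval :: "'a::field poly fract \<Rightarrow> 'a \<Rightarrow> 'a" where
  "rf_eval \<phi> x = (THE y. \<exists>p q. \<phi> = Fract p q \<and> poly q x \<noteq> 0 \<and> y = poly p x / poly q x)"

lemma rf_eval_Fract:
  fixes p q :: "'a::field poly"
  assumes "poly q x \<noteq> 0"
  shows "rf_eval (Fract p q) x = poly p x / poly q x"
  unfolding rf_eval_def
proof (rule the_equality)
  show "\<exists>p' q'. Fract p q = Fract p' q' \<and> poly q' x \<noteq> 0 \<and>
          poly p x / poly q x = poly p' x / poly q' x"
    using assms by blast
next
  fix y
  assume "\<exists>p' q'. Fract p q = Fract p' q' \<and> poly q' x \<noteq> 0 \<and> y = poly p' x / poly q' x"
  then obtain p' q' where eq: "Fract p q = Fract p' q'" and q': "poly q' x \<noteq> 0"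
    and y: "y = poly p' x / poly q' x" by blast
  have "q \<noteq> 0" "q' \<noteq> 0" using assms q' by auto
  with eq have "p * q' = p' * q" by (simp add: eq_fract)
  then have "poly p x * poly q' x = poly p' x * poly q x"
    by (metis (no_types) poly_mult)
  then show "y = poly p x / poly q x"
    unfolding y using assms q' by (simp add: frac_eq_eq)
qed

lemma eventually_rf_defined_at:
  fixes \<phi> :: "'a::field poly fract"
  assumes "inj s"
  shows "\<forall>\<^sub>\<infinity>n. rf_defined_at \<phi> (s n)"
proof -
  obtain p q where \<phi>: "\<phi> = Fract p q" and "q \<noteq> 0" by (cases \<phi>) auto
  then have "finite {x. poly q x = 0}" by (simp add: poly_roots_finite)
  then have "finite (s -` {x. poly q x = 0})" using assms by (rule finite_vimageI)
  then have "\<forall>\<^sub>\<infinity>n. poly q (s n) \<noteq> 0" by (simp add: eventually_cofinite vimage_def)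
  then show ?thesis by (rule eventually_mono) (auto simp: rf_defined_at_def \<phi>)
qed


section \<open>Pseudo-convergent sequences\<close>

definition pseudo_convergent :: "('a::field \<Rightarrow> ereal) \<Rightarrow> (nat \<Rightarrow> 'a) \<Rightarrow> bool" where
  "pseudo_convergent v s \<longleftrightarrow>
     (\<forall>n. v (s (n + 1) - s n) < v (s (n + 2) - s (n + 1)))"

definition breadth_ideal :: "('a::field \<Rightarrow> ereal) \<Rightarrow> (nat \<Rightarrow> 'a) \<Rightarrow> 'a set" where
  "breadth_ideal v s = {b. \<forall>n. v b > v (s (n + 1) - s n)}"

definition transcendental_type :: "('a::field \<Rightarrow> ereal) \<Rightarrow> (nat \<Rightarrow> 'a) \<Rightarrow> bool" where
  "transcendental_type v s \<longleftrightarrow>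
     (\<forall>f :: 'a poly. \<exists>c. \<forall>\<^sub>F n in sequentially. v (poly f (s n)) = c)"

definition algebraic_type :: "('a::field \<Rightarrow> ereal) \<Rightarrow> (nat \<Rightarrow> 'a) \<Rightarrow> bool" where
  "algebraic_type v s \<longleftrightarrow>
     (\<exists>f :: 'a poly. \<forall>\<^sub>F n in sequentially. v (poly f (s n)) < v (poly f (s (n + 1))))"

lemma pseudo_convergent_inj:
  fixes v :: "'a::field \<Rightarrow> ereal"
  assumes v: "is_valuation v" and s: "pseudo_convergent v s"
  shows "inj s"
proof -
  have v0: "v 0 = \<infinity>" and mult: "\<And>x y. v (x * y) = v x + v y"
    and add: "\<And>x y. min (v x) (v y) \<le> v (x + y)"
    and fin: "\<And>x. x \<noteq> 0 \<Longrightarrow> \<bar>v x\<bar> \<noteq> \<infinity>"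
    using v by (auto simp: is_valuation_def)
  have v1: "v 1 = 0" using mult[of 1 1] fin[of 1] by (cases "v 1") auto
  have "v (-1) = 0" using mult[of "-1" "-1"] v1 fin[of "-1"] by (cases "v (-1)") auto
  then have minus: "v (- x) = v x" for x using mult[of "-1" x] by simp
  let ?d = "\<lambda>n. v (s (Suc n) - s n)"
  have step: "?d n < ?d (Suc n)" for n using s by (simp add: pseudo_convergent_def)
  have gap: "v (s (Suc (n + k)) - s n) \<le> ?d n" for n k
  proof (rule ccontr)
    assume less: "\<not> v (s (Suc (n + k)) - s n) \<le> ?d n"
    have far: "k \<noteq> 0 \<Longrightarrow> ?d n < v (s (Suc (n + k)) - s (Suc n))"
    proof (induction k)
      case (Suc k)
      have mono: "?d n < ?d (Suc (n + k))"
        by (rule lift_Suc_mono_less[of ?d, OF step]) simp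
      show ?case
      proof (cases "k = 0")
        case True
        then show ?thesis using mono by simp
      next
        case False
        have "?d n < min (?d (Suc (n + k))) (v (s (Suc (n + k)) - s (Suc n)))"
          using mono Suc.IH[OF False] by simp
        also have "\<dots> \<le> v ((s (Suc (Suc (n + k))) - s (Suc (n + k)))
                          + (s (Suc (n + k)) - s (Suc n)))" by (rule add)
        finally show ?thesis by simp
      qed
    qed simp
    have "k \<noteq> 0" using less by (cases k) auto
    then have "?d n < min (v (s (Suc (n + k)) - s n)) (v (- (s (Suc (n + k)) - s (Suc n))))"
      using far less by (simp only: minus) simp
    also have "\<dots> \<le> v ((s (Suc (n + k)) - s n) + - (s (Suc (n + k)) - s (Suc n)))" by (rule add)
    also have "\<dots> = ?d n" by simp
    finally show False by simp
  qed
  have neq: "s (Suc (n + k)) \<noteq> s n" for n k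
  proof
    assume eq: "s (Suc (n + k)) = s n"
    have "\<infinity> \<le> ?d n" using gap[of n k] unfolding eq by (simp add: v0)
    then show False using step[of n] by auto
  qed
  show ?thesis
  proof (rule linorder_injI)
    fix m n :: nat
    assume "m < n"
    then obtain k where "n = Suc (m + k)" using less_imp_Suc_add by blast
    then show "s m \<noteq> s n" using neq[of m k] by metis
  qed
qed


section \<open>The ring and the map attached to a sequence\<close>

text \<open>Membership in \<open>V_E\<close> includes that \<open>\<phi>(s\<^sub>n)\<close> is defined.\<close>

definition ring_of_sequence ::
  "('a::field \<Rightarrow> ereal) \<Rightarrow> (nat \<Rightarrow> 'a) \<Rightarrow> 'a poly fract set" where
  "ring_of_sequence v s =
     {\<phi>. \<forall>\<^sub>\<infinity>n. rf_defined_at \<phi> (s n) \<and> rf_eval \<phi> (s n) \<in> valuation_ring v}"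

text \<open>
  \<^const>\<open>lim\<close> is unspecified for divergent sequences, so convergence has to be asserted
  separately wherever this map is used.
\<close>

definition sequence_valuation ::
  "('a::field \<Rightarrow> ereal) \<Rightarrow> (nat \<Rightarrow> 'a) \<Rightarrow> 'a poly fract \<Rightarrow> ereal" where
  "sequence_valuation v s \<phi> = lim (\<lambda>n. v (rf_eval \<phi> (s n)))"

end

theory Submission
  imports Defs
begin

text \<open>
  The point is that \<open>v (f(s\<^sub>n))\<close> has a finite limit for every nonzero polynomial \<open>f\<close>, of degree
  \<open>d\<close> say.  For transcendental type it is eventually constant.  If the breadth ideal is nonzero,
  the values \<open>\<delta>\<^sub>n = v (s\<^sub>n\<^sub>+\<^sub>1 - s\<^sub>n)\<close> increase to some real \<open>\<delta>\<close>.  Lagrange interpolation at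
  \<open>d + 1\<close> points \<open>s\<^sub>k\<close> with indices \<open>k \<ge> N\<close> shows that every \<open>v (f(s\<^sub>n))\<close> with \<open>n \<ge> N\<close> is at
  least the minimum of the sampled values \<open>v (f(s\<^sub>k))\<close> minus \<open>d (\<delta> - \<delta>\<^sub>N)\<close>.  Sampling where the
  values are close to their upper limit, and then letting \<open>N\<close> grow, shows that the lower limit is
  not smaller than the upper limit.  The same interpolation at a fixed point where \<open>f\<close> does not
  vanish bounds the limit from above.  This avoids extending \<open>v\<close> to an algebraic closure.
\<close>

section \<open>Lagrange interpolation\<close>

text \<open>Both sides are polynomials in \<open>x\<close> of degree below \<open>card A\<close>,
  and they agree on \<open>A\<close>, because the product belonging to \<open>a\<close> is 1 at
  \<open>a\<close> and 0 at every other node. Hence they coincide.\<close>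

lemma lagrange_interpolation:
  fixes f :: "'a::field poly"
  assumes fin: "finite A" and deg: "degree f < card A"
  shows "poly f x = (\<Sum>a\<in>A. poly f a * (\<Prod>b\<in>A - {a}. (x - b) / (a - b)))"
proof -
  define B where "B a = (\<Prod>b\<in>A - {a}. smult (inverse (a - b)) [:- b, 1:])" for a
  define g where "g = (\<Sum>a\<in>A. smult (poly f a) (B a))"
  have poly_B: "poly (B a) y = (\<Prod>b\<in>A - {a}. (y - b) / (a - b))" for a y
    unfolding B_def poly_prod by (intro prod.cong refl) (simp add: divide_inverse algebra_simps)
  have poly_g: "poly g y = (\<Sum>a\<in>A. poly f a * (\<Prod>b\<in>A - {a}. (y - b) / (a - b)))" for y
    by (simp add: g_def poly_sum poly_B)
  have "degree (B a) \<le> card A - 1" if "a \<in> A" for a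
  proof -
    have "degree (B a) \<le> (\<Sum>b\<in>A - {a}. degree (smult (inverse (a - b)) [:- b, 1:]))"
      unfolding B_def by (rule order.trans[OF degree_prod_sum_le]) (use fin in simp_all)
    also have "\<dots> \<le> (\<Sum>b\<in>A - {a}. 1)" by (intro sum_mono) simp
    finally show ?thesis using that fin by simp
  qed
  then have "degree g \<le> card A - 1"
    unfolding g_def by (intro degree_sum_le fin) (meson degree_smult_le le_trans)
  then have deg_g: "degree g < card A" using deg by linarith
  have "poly f a = poly g a" if "a \<in> A" for a
  proof -
    have "poly g a = (\<Sum>c\<in>A. if c = a then poly f a else 0)"
      unfolding poly_g
    proof (intro sum.cong refl)
      fix c assume c: "c \<in> A"
      show "poly f c * (\<Prod>b\<in>A - {c}. (a - b) / (c - b)) = (if c = a then poly f a else 0)"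
      proof (cases "c = a")
        case True
        have "(\<Prod>b\<in>A - {a}. (a - b) / (a - b)) = 1" by (intro prod.neutral) auto
        then show ?thesis using True by simp
      next
        case False
        have "(\<Prod>b\<in>A - {c}. (a - b) / (c - b)) = 0"
          using False that fin by (intro prod_zero) auto
        then show ?thesis using False by simp
      qed
    qed
    then show ?thesis using that fin by simp
  qed
  then have "f = g" using deg deg_g by (intro poly_eqI_degree)
  then show ?thesis using poly_g by metis
qed

section \<open>Sequences dominated by finite samples\<close>

text \<open>If the lower limit were below the upper one, take reals x < y strictly between them.
  Infinitely many terms are at least y, so \<open>m\<close> of them can be sampled beyond the
  \<open>N\<close> for \<epsilon> = y - x. All terms from \<open>N\<close> on are then at least x, a
  contradiction. It is essential that \<open>N\<close> depends on \<epsilon> alone, since the sample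
  is chosen afterwards.\<close>

lemma convergent_if_dominated_by_samples:
  fixes a :: "nat \<Rightarrow> ereal" and m :: nat
  assumes dom: "\<And>\<epsilon>::real. 0 < \<epsilon> \<Longrightarrow>
    \<exists>N. \<forall>I c n. finite I \<and> card I = m \<and> I \<subseteq> {N..} \<and> (\<forall>k\<in>I. ereal c \<le> a k) \<and> N \<le> n
      \<longrightarrow> ereal (c - \<epsilon>) \<le> a n"
  shows "convergent a"
proof -
  have "limsup a \<le> liminf a"
  proof (rule ccontr)
    assume "\<not> limsup a \<le> liminf a"
    then have "liminf a < limsup a" by simp
    then obtain x where x: "liminf a < ereal x" "ereal x < limsup a"
      using ereal_dense2 by blast
    then obtain y where y: "ereal x < ereal y" "ereal y < limsup a"
      using ereal_dense2 by blast
    obtain N where N: "\<And>I c n. finite I \<Longrightarrow> card I = m \<Longrightarrow> I \<subseteq> {N..} \<Longrightarrow>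
        (\<forall>k\<in>I. ereal c \<le> a k) \<Longrightarrow> N \<le> n \<Longrightarrow> ereal (c - (y - x)) \<le> a n"
      using dom[of "y - x"] y(1) by auto
    have "\<exists>k\<ge>M. ereal y \<le> a k" for M
    proof (rule ccontr)
      assume "\<not> ?thesis"
      then have "\<forall>\<^sub>F k in sequentially. a k \<le> ereal y"
        unfolding eventually_sequentially using linear by blast
      then have "limsup a \<le> ereal y" by (rule Limsup_bounded)
      then show False using y(2) by simp
    qed
    then have "infinite {k. N \<le> k \<and> ereal y \<le> a k}"
      unfolding infinite_nat_iff_unbounded_le by (metis (mono_tags) max.bounded_iff mem_Collect_eq)
    then obtain I where I: "finite I" "card I = m" "I \<subseteq> {k. N \<le> k \<and> ereal y \<le> a k}"
      using infinite_arbitrarily_large by metis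
    have "ereal (y - (y - x)) \<le> a n" if "N \<le> n" for n
      using I that by (intro N[of I]) auto
    then have "\<forall>\<^sub>F n in sequentially. ereal x \<le> a n"
      unfolding eventually_sequentially by auto
    then have "ereal x \<le> liminf a" by (rule Liminf_bounded)
    then show False using x(1) by simp
  qed
  then show ?thesis
    unfolding convergent_ereal using Liminf_le_Limsup[of sequentially a]
    by (simp add: order.antisym)
qed

section \<open>Real-valued valuations\<close>

locale field_valuation =
  fixes v :: "'a::field \<Rightarrow> ereal"
  assumes is_val: "is_valuation v"
begin

lemma v_0 [simp]: "v 0 = \<infinity>"
  and v_mult: "v (x * y) = v x + v y"
  and v_add: "min (v x) (v y) \<le> v (x + y)"
  and v_finite: "x \<noteq> 0 \<Longrightarrow> \<bar>v x\<bar> \<noteq> \<infinity>"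
  using is_val by (auto simp: is_valuation_def)

lemma v_real: assumes "x \<noteq> 0" obtains r where "v x = ereal r"
  using v_finite[OF assms] by (cases "v x") auto

lemma v_real_lower: obtains r where "ereal r \<le> v x"
proof (cases "x = 0")
  case True
  then show ?thesis using that[of 0] by simp
next
  case False
  then obtain r where "v x = ereal r" by (rule v_real)
  then show ?thesis using that[of r] by simp
qed

lemma v_1 [simp]: "v 1 = 0"
  using v_mult[of 1 1] v_finite[of 1] by (cases "v 1") auto

lemma v_minus [simp]: "v (- x) = v x"
proof -
  have "v (-1) = 0" using v_mult[of "-1" "-1"] v_finite[of "-1"] by (cases "v (-1)") auto
  then show ?thesis using v_mult[of "-1" x] by simp
qed

lemma v_diff: "min (v x) (v y) \<le> v (x - y)"
  using v_add[of x "- y"] by simp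

lemma v_diff_commute: "v (x - y) = v (y - x)"
  using v_minus[of "x - y"] by simp

lemma v_add_eq_left: assumes "v x < v y" shows "v (x + y) = v x"
proof (rule antisym)
  show "v x \<le> v (x + y)" using v_add[of x y] assms by (simp add: min_def split: if_splits)
  show "v (x + y) \<le> v x"
    using v_diff[of "x + y" y] assms by (auto simp: min_def split: if_splits)
qed

lemma v_divide: assumes "y \<noteq> 0" shows "v (x / y) = v x - v y"
proof -
  obtain r where r: "v y = ereal r" using v_real[OF assms] .
  have "v x = v (x / y) + v y" using assms v_mult[of "x / y" y] by simp
  then show ?thesis using r by (cases "v (x / y)") auto
qed

lemma v_prod: "v (prod f A) = (\<Sum>i\<in>A. v (f i))"
  by (induction A rule: infinite_finite_induct) (auto simp: v_mult)

lemma v_sum_ge: "(\<And>i. i \<in> A \<Longrightarrow> c \<le> v (f i)) \<Longrightarrow> c \<le> v (sum f A)"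
proof (induction A rule: infinite_finite_induct)
  case (insert i A)
  have "c \<le> min (v (f i)) (v (sum f A))" using insert by simp
  also have "\<dots> \<le> v (f i + sum f A)" by (rule v_add)
  finally show ?case using insert.hyps by simp
qed auto

text \<open>With exactly \<open>Suc (degree f)\<close> nodes, each Lagrange basis product has
  \<open>degree f\<close> factors, and each factor has value at least \<alpha> - \<beta>. The
  ultrametric inequality then bounds the sum. The point \<open>x\<close> may itself be a node, where
  the value of the difference is infinite.\<close>

lemma v_poly_ge_samples:
  fixes \<alpha> \<beta> c :: real
  assumes fin: "finite A" and card: "card A = Suc (degree f)"
    and num: "\<And>b. b \<in> A \<Longrightarrow> ereal \<alpha> \<le> v (x - b)"
    and den: "\<And>a b. a \<in> A \<Longrightarrow> b \<in> A \<Longrightarrow> a \<noteq> b \<Longrightarrow> v (a - b) \<le> ereal \<beta>"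
    and val: "\<And>a. a \<in> A \<Longrightarrow> ereal c \<le> v (poly f a)"
  shows "ereal (c + degree f * (\<alpha> - \<beta>)) \<le> v (poly f x)"
proof -
  have term_ge: "ereal (c + degree f * (\<alpha> - \<beta>)) \<le> v (poly f a * (\<Prod>b\<in>A - {a}. (x - b) / (a - b)))"
    if a: "a \<in> A" for a
  proof -
    have "ereal (\<alpha> - \<beta>) \<le> v ((x - b) / (a - b))" if "b \<in> A - {a}" for b
    proof -
      have ab: "a - b \<noteq> 0" using that by auto
      obtain r where r: "v (a - b) = ereal r" using v_real[OF ab] .
      have "r \<le> \<beta>" using den[of a b] a that r by auto
      then show ?thesis
        unfolding v_divide[OF ab] r using num[of b] that by (cases "v (x - b)") auto
    qed
    then have "(\<Sum>b\<in>A - {a}. ereal (\<alpha> - \<beta>)) \<le> (\<Sum>b\<in>A - {a}. v ((x - b) / (a - b)))"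
      by (intro sum_mono)
    moreover have "(\<Sum>b\<in>A - {a}. ereal (\<alpha> - \<beta>)) = ereal (degree f * (\<alpha> - \<beta>))"
      using a fin card by simp
    ultimately have "ereal c + ereal (degree f * (\<alpha> - \<beta>)) \<le>
        v (poly f a) + v (\<Prod>b\<in>A - {a}. (x - b) / (a - b))"
      using val[OF a] by (intro add_mono) (auto simp: v_prod)
    then show ?thesis by (simp add: v_mult)
  qed
  have "poly f x = (\<Sum>a\<in>A. poly f a * (\<Prod>b\<in>A - {a}. (x - b) / (a - b)))"
    using fin card by (intro lagrange_interpolation) auto
  then show ?thesis by (rule ssubst) (rule v_sum_ge[OF term_ge])
qed

section \<open>Value group and rank\<close>

lemma value_group_closed:
  assumes "a \<in> value_group v" "b \<in> value_group v"
  shows "a + b \<in> value_group v" "- a \<in> value_group v"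
proof -
  obtain x y where xy: "x \<noteq> 0" "v x = ereal a" "y \<noteq> 0" "v y = ereal b"
    using assms by (auto simp: value_group_def)
  then have "v (x * y) = ereal (a + b)" "v (1 / x) = ereal (- a)"
    by (auto simp: v_mult v_divide)
  then show "a + b \<in> value_group v" "- a \<in> value_group v"
    using xy by (auto simp: value_group_def intro: exI[of _ "x * y"] exI[of _ "1 / x"])
qed

lemma zero_in_value_group: "0 \<in> value_group v"
  by (auto simp: value_group_def intro!: exI[of _ 1])

text \<open>By the Archimedean property, every nontrivial convex subgroup is the whole group.\<close>

lemma valuation_rank_eq_1_iff: "valuation_rank v = 1 \<longleftrightarrow> value_group v \<noteq> {0}"
proof
  assume rank: "valuation_rank v = 1"
  show "value_group v \<noteq> {0}"
  proof
    assume "value_group v = {0}"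
    then have none: "{H. convex_subgroup H (value_group v) \<and> H \<noteq> value_group v} = {}"
      by (auto simp: convex_subgroup_def)
    show False using rank unfolding valuation_rank_def none by simp
  qed
next
  let ?G = "value_group v"
  assume nontriv: "?G \<noteq> {0}"
  have "H = {0}" if H: "convex_subgroup H ?G" and proper: "H \<noteq> ?G" for H
  proof (rule ccontr)
    assume "H \<noteq> {0}"
    have sub: "H \<subseteq> ?G" and z: "0 \<in> H" and add: "\<And>a b. a \<in> H \<Longrightarrow> b \<in> H \<Longrightarrow> a + b \<in> H"
      and neg: "\<And>a. a \<in> H \<Longrightarrow> - a \<in> H"
      and conv: "\<And>h g. h \<in> H \<Longrightarrow> g \<in> ?G \<Longrightarrow> 0 \<le> g \<Longrightarrow> g \<le> h \<Longrightarrow> g \<in> H"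
      using H by (auto simp: convex_subgroup_def)
    obtain h0 where "h0 \<in> H" "h0 \<noteq> 0" using \<open>H \<noteq> {0}\<close> z by auto
    then have "\<bar>h0\<bar> \<in> H" "0 < \<bar>h0\<bar>" using neg by (auto simp: abs_if)
    then obtain h where h: "h \<in> H" "0 < h" by blast
    have mult: "real n * h \<in> H" for n
      by (induction n) (use z h add in \<open>auto simp: algebra_simps\<close>)
    have pos: "g \<in> H" if "g \<in> ?G" "0 \<le> g" for g
    proof -
      obtain n where "g < real n * h" using reals_Archimedean3[OF h(2)] by blast
      then show ?thesis using conv[OF mult[of n] that] by simp
    qed
    have "g \<in> H" if g: "g \<in> ?G" for g
    proof (cases "0 \<le> g")
      case False
      then have "- g \<in> H" using pos[of "- g"] value_group_closed(2)[OF g g] by simp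
      then show ?thesis using neg by fastforce
    qed (use pos g in auto)
    then show False using sub proper by auto
  qed
  moreover have "convex_subgroup {0} ?G"
    using zero_in_value_group by (auto simp: convex_subgroup_def)
  ultimately have "{H. convex_subgroup H ?G \<and> H \<noteq> ?G} = {{0}}"
    using nontriv by blast
  then show "valuation_rank v = 1" by (simp add: valuation_rank_def)
qed

end

section \<open>Evaluation of rational functions\<close>

lemma rf_eval_add:
  assumes "rf_defined_at \<phi> x" "rf_defined_at \<psi> x"
  shows "rf_eval (\<phi> + \<psi>) x = rf_eval \<phi> x + rf_eval \<psi> x"
proof -
  obtain p q p' q' where \<phi>: "\<phi> = Fract p q" "poly q x \<noteq> 0" and \<psi>: "\<psi> = Fract p' q'" "poly q' x \<noteq> 0"
    using assms unfolding rf_defined_at_def by metis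
  have nz: "q \<noteq> 0" "q' \<noteq> 0" using \<phi> \<psi> by auto
  have "\<phi> + \<psi> = Fract (p * q' + p' * q) (q * q')" unfolding \<phi> \<psi> using nz by simp
  then show ?thesis
    using \<phi> \<psi> by (simp add: rf_eval_Fract add_frac_eq)
qed

lemma rf_eval_mult:
  assumes "rf_defined_at \<phi> x" "rf_defined_at \<psi> x"
  shows "rf_eval (\<phi> * \<psi>) x = rf_eval \<phi> x * rf_eval \<psi> x"
proof -
  obtain p q p' q' where \<phi>: "\<phi> = Fract p q" "poly q x \<noteq> 0" and \<psi>: "\<psi> = Fract p' q'" "poly q' x \<noteq> 0"
    using assms unfolding rf_defined_at_def by metis
  then show ?thesis by (simp add: rf_eval_Fract)
qed

lemma rf_eval_const [simp]: "rf_eval (rf_const c) x = c"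
  by (simp add: rf_const_def rf_eval_Fract)

lemma rf_eval_0 [simp]: "rf_eval 0 x = 0"
  using rf_eval_const[of 0 x] by (simp add: rf_const_def fract_collapse)

section \<open>Pseudo-convergent sequences\<close>

locale pseudo_convergent_sequence = field_valuation v
  for v :: "'a::field \<Rightarrow> ereal" +
  fixes s :: "nat \<Rightarrow> 'a"
  assumes pc: "pseudo_convergent v s"
begin

lemma inj_s: "inj s"
  using pseudo_convergent_inj[OF is_val pc] .

text \<open>Consecutive terms differ by injectivity, so nothing is lost in passing to real numbers,
  where subtraction and suprema are easier to handle.\<close>

definition gap :: "nat \<Rightarrow> real" where
  "gap n = real_of_ereal (v (s (Suc n) - s n))"

lemma v_Suc_diff: "v (s (Suc n) - s n) = ereal (gap n)"
proof -
  have "s (Suc n) - s n \<noteq> 0" using inj_s by (simp add: inj_eq)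
  then show ?thesis using v_finite unfolding gap_def by (simp add: ereal_real)
qed

lemma gap_strict_mono: "strict_mono gap"
proof -
  have "gap n < gap (Suc n)" for n
    using pc v_Suc_diff[of "Suc n"] by (auto simp: pseudo_convergent_def v_Suc_diff)
  then show ?thesis by (simp add: strict_mono_Suc_iff)
qed

lemma gap_mono: "m \<le> n \<Longrightarrow> gap m \<le> gap n"
  using gap_strict_mono by (simp add: strict_mono_less_eq)

text \<open>Descending induction on \<open>m\<close>: the first step \<open>s (Suc m) - s m\<close>
  has strictly smaller value than the remaining difference \<open>s n - s (Suc m)\<close>, so it
  determines the value of the sum.\<close>

lemma v_s_diff: "m < n \<Longrightarrow> v (s n - s m) = ereal (gap m)"
proof (induction rule: strict_inc_induct)
  case (base m)
  then show ?case using v_Suc_diff by simp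
next
  case (step m)
  have "v ((s (Suc m) - s m) + (s n - s (Suc m))) = v (s (Suc m) - s m)"
    using step gap_strict_mono by (intro v_add_eq_left) (simp add: v_Suc_diff strict_mono_less)
  then show ?case by (simp add: v_Suc_diff)
qed

lemma v_s_diff_min: "m \<noteq> n \<Longrightarrow> v (s n - s m) = ereal (gap (min m n))"
proof (cases m n rule: linorder_cases)
  case greater
  then show ?thesis using v_s_diff[of n m] by (simp add: v_diff_commute[of "s n" "s m"])
qed (use v_s_diff[of m n] in simp_all)

section \<open>Finite limits of polynomial values along the sequence\<close>

lemma eventually_poly_nonzero:
  assumes "f \<noteq> 0"
  shows "\<forall>\<^sub>F n in sequentially. poly f (s n) \<noteq> 0"
proof -
  have "finite (s -` {x. poly f x = 0})"
    using assms inj_s by (intro finite_vimageI poly_roots_finite)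
  then show ?thesis
    by (simp add: cofinite_eq_sequentially[symmetric] eventually_cofinite vimage_def)
qed

text \<open>The eventual constant value is the limit. It is finite because a nonzero polynomial has
  only finitely many roots among the distinct terms of \<open>s\<close>.\<close>

lemma v_poly_tendsto_transcendental:
  assumes "transcendental_type v s" and f: "f \<noteq> 0"
  shows "\<exists>r. (\<lambda>n. v (poly f (s n))) \<longlonglongrightarrow> ereal r"
proof -
  obtain c where c: "\<forall>\<^sub>F n in sequentially. v (poly f (s n)) = c"
    using assms(1) unfolding transcendental_type_def by blast
  then have "\<forall>\<^sub>F n in sequentially. \<bar>c\<bar> \<noteq> \<infinity>"
    using eventually_poly_nonzero[OF f] by eventually_elim (use v_finite in metis)
  then have "\<bar>c\<bar> \<noteq> \<infinity>" by simp
  then obtain r where "c = ereal r" by (cases c) auto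
  then show ?thesis using tendsto_eventually[OF c] by blast
qed

text \<open>The value of any nonzero element of the breadth ideal is a real upper bound.\<close>

lemma gap_bounded:
  assumes "breadth_ideal v s \<noteq> {0}"
  shows "\<exists>B. \<forall>n. gap n \<le> B"
proof -
  have "0 \<in> breadth_ideal v s" by (simp add: breadth_ideal_def v_Suc_diff)
  then obtain b where b: "b \<noteq> 0" "b \<in> breadth_ideal v s" using assms by auto
  obtain r where "v b = ereal r" using v_real[OF b(1)] .
  then have "\<forall>n. gap n \<le> r" using b(2) by (auto simp: breadth_ideal_def v_Suc_diff less_imp_le)
  then show ?thesis by blast
qed

text \<open>The difference of two distinct sample points has a gap as its value, so any bound on the
  gaps controls the denominators of the interpolation formula.\<close>

lemma v_poly_ge_samples_seq:
  fixes \<alpha> \<delta> c :: real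
  assumes I: "finite I" "card I = Suc (degree f)"
    and num: "\<And>k. k \<in> I \<Longrightarrow> ereal \<alpha> \<le> v (x - s k)"
    and \<delta>: "\<And>n. gap n \<le> \<delta>"
    and val: "\<And>k. k \<in> I \<Longrightarrow> ereal c \<le> v (poly f (s k))"
  shows "ereal (c + degree f * (\<alpha> - \<delta>)) \<le> v (poly f x)"
proof (rule v_poly_ge_samples[of "s ` I"])
  show "card (s ` I) = Suc (degree f)"
    using I inj_s by (simp add: card_image inj_on_subset)
  show "v (a - b) \<le> ereal \<delta>" if "a \<in> s ` I" "b \<in> s ` I" "a \<noteq> b" for a b
  proof -
    obtain k l where kl: "a = s k" "b = s l" using \<open>a \<in> s ` I\<close> \<open>b \<in> s ` I\<close> by blast
    then have "l \<noteq> k" using \<open>a \<noteq> b\<close> by auto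
    then show ?thesis using \<delta> by (simp add: kl v_s_diff_min)
  qed
  show "finite (s ` I)" using I(1) by simp
  show "ereal \<alpha> \<le> v (x - b)" if "b \<in> s ` I" for b
    using that by (elim imageE) (simp add: num)
  show "ereal c \<le> v (poly f a)" if "a \<in> s ` I" for a
    using that by (elim imageE) (simp add: val)
qed

text \<open>The differences of the points \<open>s\<^sub>k\<close> with \<open>k \<ge> N\<close> have values between \<open>gap N\<close> and the
  supremum of the gaps, so interpolation loses less and less as \<open>N\<close> grows. This is where
  the breadth ideal being nonzero matters.\<close>

lemma v_poly_convergent:
  assumes "breadth_ideal v s \<noteq> {0}"
  shows "convergent (\<lambda>n. v (poly f (s n)))"
proof (rule convergent_if_dominated_by_samples[where m = "Suc (degree f)"])
  fix \<epsilon> :: real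
  assume "0 < \<epsilon>"
  obtain B where "\<forall>n. gap n \<le> B" using gap_bounded[OF assms] by blast
  then have bdd: "bdd_above (range gap)" by (auto intro: bdd_aboveI)
  define \<delta> where "\<delta> = (SUP n. gap n)"
  have le: "gap n \<le> \<delta>" for n unfolding \<delta>_def using bdd by (intro cSUP_upper) auto
  \<comment> \<open>Dividing by the degree plus one also covers constant polynomials.\<close>
  define \<eta> where "\<eta> = \<epsilon> / Suc (degree f)"
  have "0 < \<eta>" using \<open>0 < \<epsilon>\<close> by (simp add: \<eta>_def)
  then have "\<delta> - \<eta> < (SUP n. gap n)" by (simp add: \<delta>_def)
  then obtain N where N: "\<delta> - \<eta> < gap N" using less_cSUP_iff[OF _ bdd] by auto
  have "degree f * (\<delta> - gap N) \<le> Suc (degree f) * \<eta>"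
    using N le[of N] by (intro mult_mono) auto
  then have loss: "degree f * (\<delta> - gap N) \<le> \<epsilon>" by (simp add: \<eta>_def)
  show "\<exists>N. \<forall>I c n. finite I \<and> card I = Suc (degree f) \<and> I \<subseteq> {N..} \<and>
          (\<forall>k\<in>I. ereal c \<le> v (poly f (s k))) \<and> N \<le> n \<longrightarrow> ereal (c - \<epsilon>) \<le> v (poly f (s n))"
  proof (intro exI[of _ N] allI impI, elim conjE)
    fix I c n
    assume I: "finite I" "card I = Suc (degree f)" "I \<subseteq> {N..}"
      and val: "\<forall>k\<in>I. ereal c \<le> v (poly f (s k))" and n: "N \<le> n"
    \<comment> \<open>For \<open>k = n\<close> the value is infinite; otherwise it is the gap at
      \<open>min k n\<close>, and this index is at least \<open>N\<close>.\<close>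
    have "ereal (gap N) \<le> v (s n - s k)" if "k \<in> I" for k
      using that I(3) n by (cases "k = n") (auto simp: v_s_diff_min intro!: gap_mono)
    then have "ereal (c + degree f * (gap N - \<delta>)) \<le> v (poly f (s n))"
      using I val le by (intro v_poly_ge_samples_seq[of I]) auto
    moreover have "c - \<epsilon> \<le> c + degree f * (gap N - \<delta>)"
      using loss by (simp add: algebra_simps)
    ultimately show "ereal (c - \<epsilon>) \<le> v (poly f (s n))"
      by (meson ereal_less_eq(3) order.trans)
  qed
qed

text \<open>This excludes the limit -\<infinity>. The terms of \<open>s\<close> have values bounded
  below, and the bound passes to \<open>f\<close> by induction along Horner's scheme.\<close>

lemma v_poly_bounded_below: "\<exists>c::real. \<forall>n. ereal c \<le> v (poly f (s n))"
proof -
  \<comment> \<open>Each term is compared with \<open>s 0\<close>. The real \<open>r\<close> stands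
    in for \<open>v (s 0)\<close>, which may be infinite.\<close>
  have s_ge: "ereal (min (gap 0) r) \<le> v (s n)" if r: "ereal r \<le> v (s 0)" for n r
  proof (cases "n = 0")
    case False
    have "ereal (min (gap 0) r) \<le> min (v (s n - s 0)) (v (s 0))"
      using r v_s_diff[of 0 n] False by (auto simp: min_le_iff_disj)
    also have "\<dots> \<le> v (s n)" using v_add[of "s n - s 0" "s 0"] by simp
    finally show ?thesis .
  qed (use r in \<open>auto simp: min_le_iff_disj\<close>)
  obtain r where r: "ereal r \<le> v (s 0)" by (rule v_real_lower)
  define t where "t = min (gap 0) r"
  have t: "ereal t \<le> v (s n)" for n unfolding t_def using r by (rule s_ge)
  show ?thesis
  proof (induction f)
    case 0
    show ?case by simp
  next
    case (pCons a f)
    then obtain c where c: "\<forall>n. ereal c \<le> v (poly f (s n))" by blast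
    obtain r where r: "ereal r \<le> v a" by (rule v_real_lower)
    have "ereal (min r (t + c)) \<le> v (poly (pCons a f) (s n))" for n
    proof -
      have "ereal t + ereal c \<le> v (s n) + v (poly f (s n))" using t c by (intro add_mono) auto
      then have "ereal (min r (t + c)) \<le> min (v a) (v (s n * poly f (s n)))"
        using r by (auto simp: v_mult min_le_iff_disj)
      also have "\<dots> \<le> v (poly (pCons a f) (s n))"
        using v_add[of a "s n * poly f (s n)"] by simp
      finally show ?thesis .
    qed
    then show ?case by blast
  qed
qed

lemma v_poly_tendsto_breadth:
  assumes breadth: "breadth_ideal v s \<noteq> {0}" and f: "f \<noteq> 0"
  shows "\<exists>r. (\<lambda>n. v (poly f (s n))) \<longlonglongrightarrow> ereal r"
proof -
  obtain L where L: "(\<lambda>n. v (poly f (s n))) \<longlonglongrightarrow> L"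
    using v_poly_convergent[OF breadth] unfolding convergent_def by blast
  obtain c where "\<forall>n. ereal c \<le> v (poly f (s n))" using v_poly_bounded_below by blast
  then have "ereal c \<le> L" using L by (intro LIMSEQ_le_const) auto
  then have "L \<noteq> - \<infinity>" by auto
  moreover have "L \<noteq> \<infinity>"
  proof
    assume "L = \<infinity>"
    obtain \<delta> where \<delta>: "\<And>n. gap n \<le> \<delta>" using gap_bounded[OF breadth] by blast
    obtain m where m: "poly f (s m) \<noteq> 0"
      using eventually_happens[OF eventually_poly_nonzero[OF f]] by auto
    obtain r where r: "v (poly f (s m)) = ereal r" using v_real[OF m] .
    \<comment> \<open>Chosen so that interpolation from samples of value at least \<open>C\<close>
      yields the lower bound r + 1 for \<open>v (poly f (s m))\<close>, which equals r.\<close>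
    define C where "C = r + degree f * (\<delta> - gap 0) + 1"
    have "\<forall>\<^sub>F n in sequentially. ereal C < v (poly f (s n))"
      using L \<open>L = \<infinity>\<close> by (simp add: tendsto_PInfty)
    then obtain N where N: "\<And>n. N \<le> n \<Longrightarrow> ereal C < v (poly f (s n))"
      unfolding eventually_sequentially by blast
    define I where "I = {N..N + degree f}"
    have "ereal (gap 0) \<le> v (s m - s k)" for k
      by (cases "k = m") (auto simp: v_s_diff_min intro!: gap_mono)
    then have "ereal (C + degree f * (gap 0 - \<delta>)) \<le> v (poly f (s m))"
      using N \<delta> by (intro v_poly_ge_samples_seq[of I]) (auto simp: I_def less_imp_le)
    then show False by (simp add: r C_def algebra_simps)
  qed
  ultimately show ?thesis using L by (cases L) auto
qed

end

section \<open>The limit valuation on K(X)\<close>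

locale tame_sequence = pseudo_convergent_sequence +
  assumes tame: "transcendental_type v s \<or> breadth_ideal v s \<noteq> {0}"
begin

abbreviation w where "w \<equiv> sequence_valuation v s"

lemma eventually_defined: "\<forall>\<^sub>F n in sequentially. rf_defined_at \<phi> (s n)"
  using eventually_rf_defined_at[OF inj_s] by (simp add: cofinite_eq_sequentially)

text \<open>Fix one fraction p / q. Once q does not vanish at \<open>s n\<close>, the value is that
  of p minus that of q, and both have finite limits.\<close>

lemma v_rf_eval_tendsto_real:
  assumes "\<phi> \<noteq> 0"
  shows "\<exists>r. (\<lambda>n. v (rf_eval \<phi> (s n))) \<longlonglongrightarrow> ereal r"
proof -
  obtain p q where \<phi>: "\<phi> = Fract p q" and q: "q \<noteq> 0" by (cases \<phi>) auto
  then have "p \<noteq> 0" using assms by (auto simp: fract_collapse)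
  then obtain a b where lims: "(\<lambda>n. v (poly p (s n))) \<longlonglongrightarrow> ereal a" "(\<lambda>n. v (poly q (s n))) \<longlonglongrightarrow> ereal b"
    using q tame v_poly_tendsto_transcendental v_poly_tendsto_breadth by metis
  have "(\<lambda>n. v (poly p (s n)) - v (poly q (s n))) \<longlonglongrightarrow> ereal a - ereal b"
    using lims by (intro tendsto_diff_ereal) auto
  moreover have "\<forall>\<^sub>F n in sequentially. v (poly p (s n)) - v (poly q (s n)) = v (rf_eval \<phi> (s n))"
    using eventually_poly_nonzero[OF q]
    by eventually_elim (simp add: \<phi> rf_eval_Fract v_divide)
  ultimately have "(\<lambda>n. v (rf_eval \<phi> (s n))) \<longlonglongrightarrow> ereal (a - b)"
    by (simp add: Lim_transform_eventually)
  then show ?thesis by blast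
qed

text \<open>Convergence is what gives \<open>lim\<close> in \<open>sequence_valuation\<close> its
  meaning. For \<phi> = 0 the sequence is constantly infinite.\<close>

lemma v_rf_eval_tendsto: "(\<lambda>n. v (rf_eval \<phi> (s n))) \<longlonglongrightarrow> w \<phi>"
proof -
  have "convergent (\<lambda>n. v (rf_eval \<phi> (s n)))"
    using v_rf_eval_tendsto_real by (cases "\<phi> = 0") (auto simp: convergent_def)
  then show ?thesis unfolding sequence_valuation_def by (simp add: convergent_LIMSEQ_iff)
qed

lemma w_eqI: "(\<lambda>n. v (rf_eval \<phi> (s n))) \<longlonglongrightarrow> L \<Longrightarrow> w \<phi> = L"
  by (rule LIMSEQ_unique[OF v_rf_eval_tendsto[of \<phi>]])

lemma w_const: "w (rf_const c) = v c"
  by (rule w_eqI) simp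

lemma w_0: "w 0 = \<infinity>"
  by (rule w_eqI) simp

lemma w_finite:
  assumes "\<phi> \<noteq> 0"
  shows "\<bar>w \<phi>\<bar> \<noteq> \<infinity>"
proof -
  obtain r where "(\<lambda>n. v (rf_eval \<phi> (s n))) \<longlonglongrightarrow> ereal r"
    using v_rf_eval_tendsto_real[OF assms] by blast
  then have "w \<phi> = ereal r" by (rule w_eqI)
  then show ?thesis by simp
qed

lemma w_gt_MInf: "w \<phi> \<noteq> - \<infinity>"
  using w_finite[of \<phi>] w_0 by force

lemma w_mult: "w (\<phi> * \<psi>) = w \<phi> + w \<psi>"
\<comment> \<open>The limit rule for sums in \<open>ereal\<close> is applied at finite limits, so
  zero factors are treated separately.\<close>
proof (cases "\<phi> = 0 \<or> \<psi> = 0")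
  case True
  then show ?thesis by (auto simp: w_0 w_gt_MInf)
next
  case False
  then have "(\<lambda>n. v (rf_eval \<phi> (s n)) + v (rf_eval \<psi> (s n))) \<longlonglongrightarrow> w \<phi> + w \<psi>"
    by (intro tendsto_add_ereal v_rf_eval_tendsto w_finite) auto
  moreover have "\<forall>\<^sub>F n in sequentially.
      v (rf_eval \<phi> (s n)) + v (rf_eval \<psi> (s n)) = v (rf_eval (\<phi> * \<psi>) (s n))"
    using eventually_defined[of \<phi>] eventually_defined[of \<psi>]
    by eventually_elim (simp add: rf_eval_mult v_mult)
  ultimately show ?thesis by (intro w_eqI) (rule Lim_transform_eventually)
qed

text \<open>The ultrametric inequality holds at every \<open>s n\<close> where both functions are
  defined, and it survives the limit because \<open>min\<close> is continuous.\<close>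

lemma w_add: "min (w \<phi>) (w \<psi>) \<le> w (\<phi> + \<psi>)"
proof (rule tendsto_le[OF _ v_rf_eval_tendsto])
  show "(\<lambda>n. min (v (rf_eval \<phi> (s n))) (v (rf_eval \<psi> (s n)))) \<longlonglongrightarrow> min (w \<phi>) (w \<psi>)"
    by (intro tendsto_min v_rf_eval_tendsto)
  show "\<forall>\<^sub>F n in sequentially.
      min (v (rf_eval \<phi> (s n))) (v (rf_eval \<psi> (s n))) \<le> v (rf_eval (\<phi> + \<psi>) (s n))"
    using eventually_defined[of \<phi>] eventually_defined[of \<psi>]
    by eventually_elim (simp add: rf_eval_add v_add)
qed simp

lemma is_valuation_w: "is_valuation w"
  unfolding is_valuation_def using w_0 w_finite w_mult w_add by blast

lemma value_group_subset: "value_group v \<subseteq> value_group w"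
proof
  fix r
  assume "r \<in> value_group v"
  then obtain x where x: "x \<noteq> 0" "v x = ereal r" by (auto simp: value_group_def)
  then have "w (rf_const x) = ereal r" by (simp add: w_const)
  moreover from this have "rf_const x \<noteq> 0" by (auto simp: w_0)
  ultimately show "r \<in> value_group w" by (auto simp: value_group_def)
qed

text \<open>The limits are real for nonzero functions, so the criterion for rank one applies to
  \<open>w\<close>, whose value group contains the nontrivial value group of
  \<open>v\<close>.\<close>

lemma rank_w:
  assumes "valuation_rank v = 1"
  shows "valuation_rank w = 1"
proof -
  interpret w: field_valuation w by unfold_locales (rule is_valuation_w)
  show ?thesis
    using assms value_group_subset zero_in_value_group
    unfolding w.valuation_rank_eq_1_iff valuation_rank_eq_1_iff by auto
qed

lemma ring_of_sequence_subset: "ring_of_sequence v s \<subseteq> valuation_ring w"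
proof
  fix \<phi>
  assume "\<phi> \<in> ring_of_sequence v s"
  then have "\<forall>\<^sub>F n in sequentially. 0 \<le> v (rf_eval \<phi> (s n))"
    unfolding ring_of_sequence_def cofinite_eq_sequentially valuation_ring_def
    by (auto elim: eventually_mono)
  then have "0 \<le> w \<phi>" using tendsto_lowerbound[OF v_rf_eval_tendsto] by simp
  then show "\<phi> \<in> valuation_ring w" by (simp add: valuation_ring_def)
qed

end

theorem proposition4p3:
  fixes v :: "'k::field \<Rightarrow> ereal" and s :: "nat \<Rightarrow> 'k"
  assumes "is_valuation v" and "valuation_rank v = 1"
    and "pseudo_convergent v s"
    and "transcendental_type v s \<or> (algebraic_type v s \<and> breadth_ideal v s \<noteq> {0})"
  shows "(\<forall>\<phi>. (\<lambda>n. v (rf_eval \<phi> (s n))) \<longlonglongrightarrow> sequence_valuation v s \<phi>) \<and>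
         (\<forall>c. sequence_valuation v s (rf_const c) = v c) \<and>
         is_valuation (sequence_valuation v s) \<and>
         valuation_rank (sequence_valuation v s) = 1 \<and>
         ring_of_sequence v s \<subseteq> valuation_ring (sequence_valuation v s)"
proof -
  interpret tame_sequence v s
    using assms by unfold_locales auto
  show ?thesis
    using v_rf_eval_tendsto w_const is_valuation_w rank_w assms(2) ring_of_sequence_subset by blast
qed

end
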